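(* Let $X_n,Y_n,M_n,P_n$ $(n\ge0)$ be the recursively defined sequences given in the context. The sequences of first differences, indexed by $n\ge 0$, satisfy $$\{\Delta X\}=\varTheta(2,1,1),\qquad \{\Delta Y\}=\varTheta(3,3,2),\qquad \{\Delta M\}=\varTheta(1,2,1),\qquad \{\Delta P\}=\varTheta(5,4,3).$$
   Context: $\operatorname{mex}(S)$ is the smallest nonnegative integer not in $S$. Set $X_0=Y_0=M_0=P_0=0$ and, for $n>0$, $X_n=\operatorname{mex}\{X_i,Y_i:i<n\}$, $M_n=\operatorname{mex}\{M_i,P_i:i<n\}$, $Y_n=X_n+M_n$, $P_n=X_n+Y_n$. For a sequence $\{s_n\}_{n\ge0}$, $\Delta s_n=s_{n+1}-s_n$, and $\{\Delta s\}$ denotes the sequence $(\Delta s_n)_{n\ge0}$. $\varTheta(a,b,c)$ is the infinite word, indexed by $n\ge0$, that is the fixed point of the morphism $\theta: a\to cabaaba,\ b\to cababa,\ c\to caba$ (it begins with $c$ and equals $\lim_{k\to\infty}\theta^k(c)$). For integers $u,v,w$ (not necessarily distinct), $\varTheta(u,v,w)$ is the integer sequence obtained from $\varTheta(a,b,c)$ by replacing every $a$ by $u$, every $b$ by $v$ and every $c$ by $w$. *)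

theory Defs
  imports Complex_Main "HOL-Library.Stream"
begin

definition mex :: "nat set \<Rightarrow> nat" where
  "mex S = (LEAST n. n \<notin> S)"

function X_seq :: "nat \<Rightarrow> nat" and Y_seq :: "nat \<Rightarrow> nat"
  and M_seq :: "nat \<Rightarrow> nat" and P_seq :: "nat \<Rightarrow> nat" where
  "X_seq n = (if n = 0 then 0 else mex (X_seq ` {..<n} \<union> Y_seq ` {..<n}))"
| "Y_seq n = (if n = 0 then 0 else X_seq n + M_seq n)"
| "M_seq n = (if n = 0 then 0 else mex (M_seq ` {..<n} \<union> P_seq ` {..<n}))"
| "P_seq n = (if n = 0 then 0 else X_seq n + Y_seq n)"
  by pat_completeness auto
termination
  by (relation "measure (\<lambda>s. case s of
        Inl (Inl n) \<Rightarrow> 3 * n | Inl (Inr n) \<Rightarrow> 3 * n + 1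
      | Inr (Inl n) \<Rightarrow> 3 * n | Inr (Inr n) \<Rightarrow> 3 * n + 2)") auto

declare X_seq.simps [simp del] Y_seq.simps [simp del] M_seq.simps [simp del] P_seq.simps [simp del]

definition \<Delta> :: "(nat \<Rightarrow> nat) \<Rightarrow> nat \<Rightarrow> int" where
  "\<Delta> s n = int (s (Suc n)) - int (s n)"

datatype letter = A | B | C

fun \<theta> :: "letter \<Rightarrow> letter list" where
  "\<theta> A = [C, A, B, A, A, B, A]"
| "\<theta> B = [C, A, B, A, B, A]"
| "\<theta> C = [C, A, B, A]"

definition \<theta>_list :: "letter list \<Rightarrow> letter list" where
  "\<theta>_list w = concat (map \<theta> w)"

definition \<theta>_stream :: "letter stream \<Rightarrow> letter stream" where
  "\<theta>_stream w = flat (smap \<theta> w)"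

definition Theta_word :: "letter stream" where
  "Theta_word = (THE w. \<theta>_stream w = w)"

fun letter_value :: "int \<Rightarrow> int \<Rightarrow> int \<Rightarrow> letter \<Rightarrow> int" where
  "letter_value u v w A = u"
| "letter_value u v w B = v"
| "letter_value u v w C = w"

definition Theta :: "int \<Rightarrow> int \<Rightarrow> int \<Rightarrow> nat \<Rightarrow> int" where
  "Theta u v w n = letter_value u v w (Theta_word !! n)"

text \<open>
  The rest justifies the definite description in \<open>Theta_word\<close>: \<open>\<theta>_stream\<close> has exactly one
  fixed point, every iterate of the morphism on \<open>C\<close> is a prefix of it, and the lengths of
  these prefixes are unbounded, so that it is the limit of the iterates.
\<close>

lemma \<theta>_starts: "\<exists>ys. \<theta> x = C # A # ys"
  by (cases x) auto

lemma \<theta>_nonempty: "\<theta> x \<noteq> []"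
  by (cases x) auto

lemma \<theta>_stream_shift: "\<theta>_stream (xs @- s) = \<theta>_list xs @- \<theta>_stream s"
  by (induction xs) (simp_all add: \<theta>_stream_def \<theta>_list_def \<theta>_nonempty)

lemma length_\<theta>_list: "2 * length w \<le> length (\<theta>_list w)"
proof (induction w)
  case (Cons x w)
  then show ?case by (cases x) (auto simp: \<theta>_list_def)
qed (simp add: \<theta>_list_def)

lemma length_iterate: "k < length ((\<theta>_list ^^ k) [C])"
proof (induction k)
  case (Suc k)
  then show ?case using length_\<theta>_list[of "(\<theta>_list ^^ k) [C]"] by simp
qed simp

lemma iterate_Suc: "\<exists>ys. (\<theta>_list ^^ Suc k) [C] = (\<theta>_list ^^ k) [C] @ ys"
proof (induction k)
  case 0
  then show ?case by (simp add: \<theta>_list_def)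
next
  case (Suc k)
  then obtain ys where "(\<theta>_list ^^ Suc k) [C] = (\<theta>_list ^^ k) [C] @ ys" by blast
  then have "(\<theta>_list ^^ Suc (Suc k)) [C] = (\<theta>_list ^^ Suc k) [C] @ \<theta>_list ys"
    by (simp add: \<theta>_list_def)
  then show ?case by blast
qed

lemma iterate_le: "k \<le> l \<Longrightarrow> \<exists>ys. (\<theta>_list ^^ l) [C] = (\<theta>_list ^^ k) [C] @ ys"
proof (induction l rule: dec_induct)
  case (step l)
  then show ?case using iterate_Suc[of l] by (metis append.assoc)
qed simp

lemma fixed_point_prefix:
  assumes "\<theta>_stream w = w"
  shows "\<exists>s. w = (\<theta>_list ^^ k) [C] @- s"
proof (induction k)
  case 0
  obtain ys where "\<theta> (shd w) = C # A # ys" using \<theta>_starts by blast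
  then have "shd (\<theta>_stream w) = C" by (simp add: \<theta>_stream_def)
  then have "w = [C] @- stl w" using assms by (metis shift.simps stream.collapse)
  then show ?case by auto
next
  case (Suc k)
  then obtain s where "w = (\<theta>_list ^^ k) [C] @- s" by blast
  then have "w = (\<theta>_list ^^ Suc k) [C] @- \<theta>_stream s"
    using assms \<theta>_stream_shift by (metis comp_apply funpow.simps(2))
  then show ?case by blast
qed

lemma fixed_point_nth:
  assumes "\<theta>_stream w = w" and "n < length ((\<theta>_list ^^ k) [C])"
  shows "w !! n = (\<theta>_list ^^ k) [C] ! n"
  using fixed_point_prefix[OF assms(1), of k] assms(2) by auto

lemma stream_eqI: "(\<And>n. s !! n = t !! n) \<Longrightarrow> s = t"
  using smap_alt[of id s t] by (simp add: stream.map_id)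

lemma ex1_fixed_point: "\<exists>!w. \<theta>_stream w = w"
proof
  define W where "W = smap (\<lambda>n. (\<theta>_list ^^ n) [C] ! n) nats"
  have nth: "W !! n = (\<theta>_list ^^ k) [C] ! n" if "n < length ((\<theta>_list ^^ k) [C])" for n k
  proof -
    have "(\<theta>_list ^^ n) [C] ! n = (\<theta>_list ^^ k) [C] ! n"
    proof (cases "k \<le> n")
      case True
      then show ?thesis using iterate_le[of k n] that by (auto simp: nth_append)
    next
      case False
      then show ?thesis using iterate_le[of n k] length_iterate[of n] by (auto simp: nth_append)
    qed
    then show ?thesis by (simp add: W_def)
  qed
  have "\<theta>_stream W !! n = W !! n" for n
  proof -
    let ?u = "(\<theta>_list ^^ n) [C]"
    have "stake (length ?u) W = ?u"
      by (rule nth_equalityI) (auto simp: nth)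
    then have W: "W = ?u @- sdrop (length ?u) W" by (metis stake_sdrop)
    have "\<theta>_stream W = (\<theta>_list ^^ Suc n) [C] @- \<theta>_stream (sdrop (length ?u) W)"
      by (subst W, subst \<theta>_stream_shift) simp
    moreover have "n < length ((\<theta>_list ^^ Suc n) [C])"
      using length_iterate[of "Suc n"] by simp
    ultimately show ?thesis using nth[of n "Suc n"] by (metis shift_snth_less)
  qed
  then show "\<theta>_stream W = W" by (rule stream_eqI)
  fix w assume "\<theta>_stream w = w"
  then have "w !! n = W !! n" for n
    using fixed_point_nth nth length_iterate by metis
  then show "w = W" by (rule stream_eqI)
qed

lemma Theta_word_fixed_point: "\<theta>_stream Theta_word = Theta_word"
  unfolding Theta_word_def by (rule theI'[OF ex1_fixed_point])

lemma Theta_word_nth: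
  "n < length ((\<theta>_list ^^ k) [C]) \<Longrightarrow> Theta_word !! n = (\<theta>_list ^^ k) [C] ! n"
  by (rule fixed_point_nth[OF Theta_word_fixed_point])

end

theory Submission
  imports Defs
begin

text \<open>
  The word \<open>\<varTheta>(a,b,c)\<close> is the Tribonacci word with one letter \<open>c\<close> put in front.
  Let \<open>\<tau>\<close> be the Tribonacci morphism \<open>a \<rightarrow> ab, b \<rightarrow> ac, c \<rightarrow> a\<close>. Its cube is conjugate
  to \<open>\<theta>\<close>: \<open>aba \<theta>(x) = \<tau>\<^sup>3(x) aba\<close> for every letter \<open>x\<close>. Hence, if \<open>c t\<close> denotes the fixed
  point of \<open>\<theta>\<close>, then \<open>c \<tau>(t)\<close> is a fixed point of \<open>\<theta>\<close> as well, and uniqueness gives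
  \<open>\<tau>(t) = t\<close> (\<open>tribonacci_fixed_point\<close>).

  Let \<open>x, y, m, p\<close> be the partial sums of \<open>\<varTheta>(2,1,1)\<close>, \<open>\<varTheta>(3,3,2)\<close>, \<open>\<varTheta>(1,2,1)\<close>,
  \<open>\<varTheta>(5,4,3)\<close>. Adding gaps letter by letter gives \<open>y = x + m\<close> and \<open>p = x + y\<close>. As the
  sequences are strictly increasing with \<open>x \<le> y\<close> and \<open>m \<le> p\<close>, the two mex rules hold as soon
  as \<open>x\<close> and \<open>y\<close> split the positive integers, and so do \<open>m\<close> and \<open>p\<close>
  (\<open>mex_of_complementary\<close>). The recursion then determines all four sequences.

  Complementarity is one more conjugacy of morphisms. The characteristic word of the set of partial
  sums is obtained from the word by the morphism that sends a letter of gap \<open>d\<close> to \<open>T\<close>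
  followed by \<open>d - 1\<close> copies of \<open>F\<close>; write \<open>\<sigma>\<^sub>x\<close>, \<open>\<sigma>\<^sub>y\<close>, \<open>\<sigma>\<^sub>m\<close>, \<open>\<sigma>\<^sub>p\<close>
  for these morphisms. The letter \<open>c\<close> in front of \<open>t\<close> contributes \<open>T\<close> to the word of
  \<open>x\<close> and \<open>TF\<close> to that of \<open>y\<close>. Past position \<open>0\<close> it remains to see that
  \<open>F \<sigma>\<^sub>y(t)\<close> arises from \<open>\<sigma>\<^sub>x(t) = \<sigma>\<^sub>x(\<tau>(t))\<close> by exchanging \<open>T\<close> and \<open>F\<close>.
  This holds because, for every letter \<open>z\<close>, exchanging \<open>T\<close> and \<open>F\<close> in
  \<open>\<sigma>\<^sub>x(\<tau>(z))\<close> and appending \<open>F\<close> gives \<open>F \<sigma>\<^sub>y(z)\<close>. For \<open>m\<close> and \<open>p\<close>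
  the same works with \<open>\<tau>\<^sup>2\<close> in place of \<open>\<tau>\<close> and \<open>FF\<close> in place of \<open>F\<close>
  (\<open>complementary_gap_sums\<close>).
\<close>

section \<open>Morphisms on infinite words\<close>

text \<open>
  The extension of a letter substitution to infinite words. It is meaningful only if no letter has
  an empty image, which the lemmas below assume.
\<close>
definition morph :: "('a \<Rightarrow> 'b list) \<Rightarrow> 'a stream \<Rightarrow> 'b stream" where
  "morph f s = flat (smap f s)"

lemma morph_SCons: "f x \<noteq> [] \<Longrightarrow> morph f (x ## s) = f x @- morph f s"
  by (simp add: morph_def)

lemma morph_shift:
  assumes "\<And>x. f x \<noteq> []"
  shows "morph f (xs @- s) = concat (map f xs) @- morph f s"
  by (induction xs) (simp_all add: morph_SCons assms)

lemma morph_unique: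
  assumes F: "\<And>x s. F (x ## s) = h x @- F s" and h: "\<And>x. h x \<noteq> []"
  shows "F s = morph h s"
proof (rule stream_eqI)
  fix n
  show "F s !! n = morph h s !! n"
  proof (induction n arbitrary: s rule: less_induct)
    case (less n)
    obtain x s' where s: "s = x ## s'" by (cases s)
    show ?case
    proof (cases "n < length (h x)")
      case True
      then show ?thesis by (simp add: s F morph_SCons h)
    next
      case False
      then have "n - length (h x) < n" using h[of x] by (cases n) auto
      then show ?thesis using less False by (simp add: s F morph_SCons h)
    qed
  qed
qed

lemma morph_conjugate:
  assumes "\<And>x. u @ f x = g x @ u" and "\<And>x. f x \<noteq> []" and "\<And>x. g x \<noteq> []"
  shows "u @- morph f s = morph g s"
proof (rule morph_unique)
  fix x s
  have "u @- morph f (x ## s) = (u @ f x) @- morph f s" by (simp add: morph_SCons assms(2))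
  then show "u @- morph f (x ## s) = g x @- u @- morph f s" by (simp add: assms(1))
qed (rule assms(3))

lemma morph_morph:
  assumes "\<And>x. f x \<noteq> []" and "\<And>x. g x \<noteq> []"
  shows "morph f (morph g s) = morph (\<lambda>x. concat (map f (g x))) s"
proof (rule morph_unique)
  show "concat (map f (g x)) \<noteq> []" for x
    using assms by (cases "g x") auto
qed (simp add: morph_SCons morph_shift assms)

lemma smap_morph:
  assumes "\<And>x. f x \<noteq> []"
  shows "smap h (morph f s) = morph (\<lambda>x. map h (f x)) s"
  by (rule morph_unique) (simp_all add: morph_SCons assms)

section \<open>The Tribonacci word\<close>

text \<open>The Tribonacci morphism.\<close>
fun \<tau> :: "letter \<Rightarrow> letter list" where
  "\<tau> A = [A, B]"
| "\<tau> B = [A, C]"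
| "\<tau> C = [A]"

lemma \<tau>_nonempty: "\<tau> x \<noteq> []"
  by (cases x) auto

lemma \<theta>_conjugate_\<tau>_cubed: "[A, B, A] @- morph \<theta> s = morph \<tau> (morph \<tau> (morph \<tau> s))"
proof -
  let ?\<tau>3 = "\<lambda>x. concat (map \<tau> (concat (map \<tau> (\<tau> x))))"
  have ne: "concat (map \<tau> (\<tau> x)) \<noteq> []" for x by (cases x) auto
  have "[A, B, A] @- morph \<theta> s = morph ?\<tau>3 s"
  proof (rule morph_conjugate)
    show "[A, B, A] @ \<theta> x = ?\<tau>3 x @ [A, B, A]" and "\<theta> x \<noteq> []" and "?\<tau>3 x \<noteq> []" for x
      by (cases x; simp)+
  qed
  also have "\<dots> = morph \<tau> (morph \<tau> (morph \<tau> s))"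
    by (simp only: morph_morph[OF \<tau>_nonempty \<tau>_nonempty] morph_morph[OF \<tau>_nonempty ne])
  finally show ?thesis .
qed

text \<open>For words that begin with \<open>c\<close>, being fixed by \<open>\<theta>\<close> means that the rest is fixed by \<open>\<tau>\<^sup>3\<close>.\<close>
lemma \<theta>_stream_SCons_C: "\<theta>_stream (C ## s) = C ## morph \<tau> (morph \<tau> (morph \<tau> s))"
  using \<theta>_conjugate_\<tau>_cubed[of s] by (simp add: \<theta>_stream_def morph_def)

lemma tribonacci_fixed_point:
  obtains t where "Theta_word = C ## t" and "morph \<tau> t = t"
proof -
  obtain t where t: "Theta_word = C ## t"
    using fixed_point_prefix[OF Theta_word_fixed_point, of 0] by auto
  have "morph \<tau> (morph \<tau> (morph \<tau> t)) = t"
    using Theta_word_fixed_point by (simp add: t \<theta>_stream_SCons_C)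
  then have "\<theta>_stream (C ## morph \<tau> t) = C ## morph \<tau> t"
    by (simp add: \<theta>_stream_SCons_C)
  then have "C ## morph \<tau> t = Theta_word"
    using ex1_fixed_point Theta_word_fixed_point by blast
  then have "morph \<tau> t = t" by (simp add: t)
  with t show ?thesis by (rule that)
qed

section \<open>Sequences with prescribed gaps\<close>

text \<open>The sequence starting at \<open>0\<close> whose successive gaps are the values of \<open>d\<close> along the word \<open>s\<close>.\<close>
definition gap_sum :: "('a \<Rightarrow> nat) \<Rightarrow> 'a stream \<Rightarrow> nat \<Rightarrow> nat" where
  "gap_sum d s n = (\<Sum>i<n. d (s !! i))"

text \<open>
  The block of length \<open>d x\<close> whose only \<open>True\<close> is its first entry, provided that \<open>d x > 0\<close>.
  Such blocks, strung together along a word, form the characteristic word of the range of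
  \<open>gap_sum\<close>.
\<close>
definition gap_block :: "('a \<Rightarrow> nat) \<Rightarrow> 'a \<Rightarrow> bool list" where
  "gap_block d x = True # replicate (d x - 1) False"

lemma gap_sum_0: "gap_sum d s 0 = 0"
  by (simp add: gap_sum_def)

lemma gap_sum_Suc: "gap_sum d s (Suc n) = gap_sum d s n + d (s !! n)"
  by (simp add: gap_sum_def)

lemma gap_sum_SCons: "gap_sum d (x ## s) (Suc n) = d x + gap_sum d s n"
  by (simp add: gap_sum_def sum.lessThan_Suc_shift del: sum.lessThan_Suc)

lemma gap_sum_add: "gap_sum (\<lambda>x. d x + e x) s n = gap_sum d s n + gap_sum e s n"
  by (simp add: gap_sum_def sum.distrib)

lemma strict_mono_gap_sum: "(\<And>x. d x > 0) \<Longrightarrow> strict_mono (gap_sum d s)"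
  by (simp add: strict_mono_Suc_iff gap_sum_Suc)

lemma gap_block_nonempty: "gap_block d x \<noteq> []"
  by (simp add: gap_block_def)

lemma characteristic_word_gap_sum:
  assumes "\<And>x. d x > 0"
  shows "morph (gap_block d) s !! k \<longleftrightarrow> k \<in> range (gap_sum d s)"
proof (induction k arbitrary: s rule: less_induct)
  case (less k)
  obtain x s' where s: "s = x ## s'" by (cases s)
  have len: "length (gap_block d x) = d x" using assms[of x] by (simp add: gap_block_def)
  have range: "k \<in> range (gap_sum d s) \<longleftrightarrow> k = 0 \<or> (\<exists>n. k = d x + gap_sum d s' n)"
  proof
    assume "k \<in> range (gap_sum d s)"
    then obtain n where "k = gap_sum d s n" by blast
    then show "k = 0 \<or> (\<exists>n. k = d x + gap_sum d s' n)"
      by (cases n) (auto simp: s gap_sum_0 gap_sum_SCons)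
  next
    assume "k = 0 \<or> (\<exists>n. k = d x + gap_sum d s' n)"
    then show "k \<in> range (gap_sum d s)"
      by (metis gap_sum_0 gap_sum_SCons rangeI s)
  qed
  show ?case
  proof (cases "k < d x")
    case True
    then have "morph (gap_block d) s !! k = gap_block d x ! k"
      by (simp add: s morph_SCons gap_block_nonempty len)
    also have "\<dots> \<longleftrightarrow> k = 0" using True by (cases k) (auto simp: gap_block_def)
    finally show ?thesis using True range by auto
  next
    case False
    then have "morph (gap_block d) s !! k = morph (gap_block d) s' !! (k - d x)"
      by (simp add: s morph_SCons gap_block_nonempty len)
    also have "\<dots> \<longleftrightarrow> k - d x \<in> range (gap_sum d s')"
      using False assms[of x] by (intro less) auto
    also have "\<dots> \<longleftrightarrow> k \<in> range (gap_sum d s)"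
    proof -
      have "k - d x = j \<longleftrightarrow> k = d x + j" for j using False by auto
      moreover have "k \<noteq> 0" using False assms[of x] by auto
      ultimately show ?thesis unfolding range by (simp add: image_iff)
    qed
    finally show ?thesis .
  qed
qed

text \<open>
  The condition \<open>conj\<close> is a conjugacy by the block of \<open>False\<close> that follows the initial
  \<open>True\<close> in the characteristic word for the gaps \<open>e\<close>. The condition \<open>d c = 1\<close> says that the
  characteristic word for the gaps \<open>d\<close> has no such block. The morphism \<open>\<rho>\<close> serves to group
  the letters of \<open>t\<close> into blocks, one for each gap \<open>e\<close>.
\<close>
lemma complementary_gap_sums:
  assumes d: "\<And>x. d x > 0" and e: "\<And>x. e x > 0" and "d c = 1"
    and \<rho>: "\<And>x. \<rho> x \<noteq> []" "morph \<rho> t = t"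
    and conj: "\<And>x. tl (gap_block e c) @ gap_block e x
                 = map Not (concat (map (gap_block d) (\<rho> x))) @ tl (gap_block e c)"
    and "k > 0"
  shows "k \<in> range (gap_sum d (c ## t)) \<longleftrightarrow> k \<notin> range (gap_sum e (c ## t))"
proof -
  obtain j where k: "k = Suc j" using \<open>k > 0\<close> by (cases k) auto
  have ne: "concat (map (gap_block d) (\<rho> x)) \<noteq> []" for x
    using \<rho>(1)[of x] by (cases "\<rho> x") (auto simp: gap_block_nonempty)
  have "tl (gap_block e c) @- morph (gap_block e) t
      = morph (\<lambda>x. map Not (concat (map (gap_block d) (\<rho> x)))) t"
    by (rule morph_conjugate[OF conj gap_block_nonempty]) (use ne in simp)
  also have "\<dots> = smap Not (morph (gap_block d) (morph \<rho> t))"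
    by (simp only: morph_morph[OF gap_block_nonempty \<rho>(1)] smap_morph[OF ne])
  finally have eq: "tl (gap_block e c) @- morph (gap_block e) t = smap Not (morph (gap_block d) t)"
    by (simp only: \<rho>(2))
  have "stl (morph (gap_block e) (c ## t)) = tl (gap_block e c) @- morph (gap_block e) t"
    and "stl (morph (gap_block d) (c ## t)) = morph (gap_block d) t"
    by (simp_all add: morph_SCons gap_block_nonempty gap_block_def \<open>d c = 1\<close>)
  then have "morph (gap_block e) (c ## t) !! k \<longleftrightarrow> \<not> morph (gap_block d) (c ## t) !! k"
    using eq by (simp add: k)
  then show ?thesis
    by (simp add: characteristic_word_gap_sum[OF d] characteristic_word_gap_sum[OF e])
qed

lemma mex_of_complementary:
  fixes f g :: "nat \<Rightarrow> nat"
  assumes f: "strict_mono f" "f 0 = 0" and g: "strict_mono g" "g 0 = 0"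
    and le: "\<And>n. f n \<le> g n"
    and compl: "\<And>k. k > 0 \<Longrightarrow> k \<in> range f \<longleftrightarrow> k \<notin> range g"
    and "n > 0"
  shows "mex (f ` {..<n} \<union> g ` {..<n}) = f n"
  unfolding mex_def
proof (rule Least_equality)
  have "f n > 0" using strict_monoD[OF f(1) \<open>n > 0\<close>] f(2) by simp
  then have "f n \<notin> range g" using compl by blast
  moreover have "f n \<notin> f ` {..<n}"
    using strict_mono_eq[OF f(1)] by auto
  ultimately show "f n \<notin> f ` {..<n} \<union> g ` {..<n}" by auto
next
  fix k
  assume k: "k \<notin> f ` {..<n} \<union> g ` {..<n}"
  have "f 0 \<in> f ` {..<n}" using \<open>n > 0\<close> by blast
  then have "k > 0" using k f(2) by (cases k) auto
  then obtain i where i: "k = f i \<or> k = g i" using compl by blast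
  then have "n \<le> i" using k by (auto simp: not_less[symmetric])
  then have "f n \<le> f i" using strict_mono_less_eq[OF f(1)] by simp
  then show "f n \<le> k" using i le[of i] by auto
qed

section \<open>The four sequences\<close>

text \<open>Natural-number counterpart of \<open>letter_value\<close>.\<close>
fun gap :: "nat \<Rightarrow> nat \<Rightarrow> nat \<Rightarrow> letter \<Rightarrow> nat" where
  "gap u v w A = u"
| "gap u v w B = v"
| "gap u v w C = w"

lemma gap_pos: "u > 0 \<Longrightarrow> v > 0 \<Longrightarrow> w > 0 \<Longrightarrow> gap u v w x > 0"
  by (cases x) auto

lemma \<Delta>_gap_sum: "\<Delta> (gap_sum (gap u v w) Theta_word) = Theta (int u) (int v) (int w)"
proof
  fix n
  have "int (gap u v w x) = letter_value (int u) (int v) (int w) x" for x by (cases x) auto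
  then show "\<Delta> (gap_sum (gap u v w) Theta_word) n = Theta (int u) (int v) (int w) n"
    by (simp add: \<Delta>_def Theta_def gap_sum_Suc)
qed

lemma sequences_unique:
  assumes zero: "x 0 = 0" "y 0 = 0" "m 0 = 0" "p 0 = 0"
    and x: "\<And>n. n > 0 \<Longrightarrow> x n = mex (x ` {..<n} \<union> y ` {..<n})"
    and m: "\<And>n. n > 0 \<Longrightarrow> m n = mex (m ` {..<n} \<union> p ` {..<n})"
    and y: "\<And>n. y n = x n + m n" and p: "\<And>n. p n = x n + y n"
  shows "X_seq n = x n \<and> Y_seq n = y n \<and> M_seq n = m n \<and> P_seq n = p n"
proof (induction n rule: less_induct)
  case (less n)
  show ?case
  proof (cases "n = 0")
    case True
    then show ?thesis
      by (simp add: X_seq.simps Y_seq.simps M_seq.simps P_seq.simps zero)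
  next
    case False
    have img: "X_seq ` {..<n} = x ` {..<n}" "Y_seq ` {..<n} = y ` {..<n}"
      "M_seq ` {..<n} = m ` {..<n}" "P_seq ` {..<n} = p ` {..<n}"
      using less by (auto intro!: image_cong)
    have X: "X_seq n = x n" using False x[of n] by (subst X_seq.simps) (simp add: img)
    have M: "M_seq n = m n" using False m[of n] by (subst M_seq.simps) (simp add: img)
    have Y: "Y_seq n = y n" using False by (subst Y_seq.simps) (simp add: X M y)
    have "P_seq n = p n" using False by (subst P_seq.simps) (simp add: X Y p)
    with X Y M show ?thesis by simp
  qed
qed

theorem theorem20:
  shows "\<Delta> X_seq = Theta 2 1 1 \<and> \<Delta> Y_seq = Theta 3 3 2 \<and>
         \<Delta> M_seq = Theta 1 2 1 \<and> \<Delta> P_seq = Theta 5 4 3"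
proof -
  obtain t where t: "Theta_word = C ## t" and \<tau>: "morph \<tau> t = t"
    by (rule tribonacci_fixed_point)
  let ?\<tau>2 = "\<lambda>x. concat (map \<tau> (\<tau> x))"
  have \<tau>2: "morph ?\<tau>2 t = t"
    by (simp only: morph_morph[OF \<tau>_nonempty \<tau>_nonempty, symmetric] \<tau>)
  define x where "x = gap_sum (gap 2 1 1) Theta_word"
  define y where "y = gap_sum (gap 3 3 2) Theta_word"
  define m where "m = gap_sum (gap 1 2 1) Theta_word"
  define p where "p = gap_sum (gap 5 4 3) Theta_word"
  note defs = x_def y_def m_def p_def
  have "gap 3 3 2 = (\<lambda>l. gap 2 1 1 l + gap 1 2 1 l)"
  proof
    show "gap 3 3 2 l = gap 2 1 1 l + gap 1 2 1 l" for l by (cases l) simp_all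
  qed
  then have y: "y n = x n + m n" for n
    by (simp only: defs gap_sum_add)
  have "gap 5 4 3 = (\<lambda>l. gap 2 1 1 l + gap 3 3 2 l)"
  proof
    show "gap 5 4 3 l = gap 2 1 1 l + gap 3 3 2 l" for l by (cases l) simp_all
  qed
  then have p: "p n = x n + y n" for n
    by (simp only: defs gap_sum_add)
  have zero: "x 0 = 0" "y 0 = 0" "m 0 = 0" "p 0 = 0"
    by (simp_all add: defs gap_sum_0)
  have mono: "strict_mono x" "strict_mono y" "strict_mono m" "strict_mono p"
    unfolding defs by (intro strict_mono_gap_sum gap_pos; simp)+
  have xy: "k \<in> range x \<longleftrightarrow> k \<notin> range y" if "k > 0" for k
    unfolding x_def y_def t
  proof (rule complementary_gap_sums[where \<rho> = \<tau>])
    show "tl (gap_block (gap 3 3 2) C) @ gap_block (gap 3 3 2) l =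
      map Not (concat (map (gap_block (gap 2 1 1)) (\<tau> l))) @ tl (gap_block (gap 3 3 2) C)" for l
      by (cases l) (simp_all add: gap_block_def numeral_eq_Suc)
  qed (simp_all add: gap_pos \<tau>_nonempty \<tau> that)
  have mp: "k \<in> range m \<longleftrightarrow> k \<notin> range p" if "k > 0" for k
    unfolding m_def p_def t
  proof (rule complementary_gap_sums[where \<rho> = ?\<tau>2])
    show "tl (gap_block (gap 5 4 3) C) @ gap_block (gap 5 4 3) l =
      map Not (concat (map (gap_block (gap 1 2 1)) (?\<tau>2 l))) @ tl (gap_block (gap 5 4 3) C)" for l
      by (cases l) (simp_all add: gap_block_def numeral_eq_Suc)
    show "?\<tau>2 l \<noteq> []" for l by (cases l) auto
  qed (simp_all add: gap_pos \<tau>2 that)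
  have "X_seq n = x n \<and> Y_seq n = y n \<and> M_seq n = m n \<and> P_seq n = p n" for n
  proof (rule sequences_unique[where x = x and y = y and m = m and p = p, OF zero _ _ y p])
    show "x n = mex (x ` {..<n} \<union> y ` {..<n})" if "n > 0" for n
      by (rule mex_of_complementary[OF mono(1) zero(1) mono(2) zero(2) _ xy that, symmetric])
        (simp add: y)
    show "m n = mex (m ` {..<n} \<union> p ` {..<n})" if "n > 0" for n
      by (rule mex_of_complementary[OF mono(3) zero(3) mono(4) zero(4) _ mp that, symmetric])
        (simp add: y p)
  qed
  then have seqs: "X_seq = x" "Y_seq = y" "M_seq = m" "P_seq = p" by auto
  show ?thesis unfolding seqs defs \<Delta>_gap_sum by simp
qed

end
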